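(* Suppose that the following conditions hold (with the notation of the context, after subtracting the fitted constant mean $\zeta^*$). (1) The feature domain $\mathcal{Z}\subset\mathbb{R}^{d_f}$ is compact, and the fitted kernel $c$ is continuous and positive definite on $\mathcal{Z}\times\mathcal{Z}$. (2) The training sites $\mathbf{z}_1,\dots,\mathbf{z}_J$ are pairwise distinct, so the fitted kernel matrix $\mathbf{C}=c(\mathbf{Z},\mathbf{Z})$ is invertible. (3) The fitted kernel, mean and regularization parameters are held fixed, with $\delta^{*2}>0$ and $\gamma=\delta^{*2}/J$. (4) The centered target $f_\star:=m_\star-\zeta^*$ belongs to the reproducing kernel Hilbert space $\mathcal{H}_c$ of $c$ on $\mathcal{Z}$, and $\|f_\star\|_{\mathcal{H}_c}\le\Gamma$ for an available (non-circular) bound $\Gamma$. (5) With $\mathbf{y}_{\mathrm{c}}:=\mathbf{y}-\zeta^*\mathbf{1}_J=f_\star(\mathbf{Z})+\mathbf{r}$, the realized training discrepancies satisfy $|\mathbf{r}|\le\bar{\mathbf{r}}$ for a known vector $\bar{\mathbf{r}}\in\mathbb{R}_{>0}^J$ (absolute values and inequalities componentwise). (6) For each online state $(m,i)$ under consideration, $|r_{m,i}|\le\bar r_{m,i}^{\mathrm{on}}$ for a specified $\bar r_{m,i}^{\mathrm{on}}\ge 0$. Then every online neighborhood under consideration satisfies $$\left|\tilde{\eta}_{m,i}^2-\eta_{m,i}^2\right|\le\varepsilon_{m,i}^{\mathrm{KRR}},\qquad \varepsilon_{m,i}^{\mathrm{KRR}}:=B_J(\mathbf{z}_{m,i})+\bar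 r_{m,i}^{\mathrm{on}},$$ where, writing $\mathbf{c}_{\mathbf{Z}}(z):=c(\mathbf{Z},z)\in\mathbb{R}^J$ for $z\in\mathcal{Z}$, $$B_J(z):=P_J(z)\left(\Gamma^2+\Delta_J-\mathbf{y}_{\mathrm{c}}^\top\mathbf{C}^{-1}\mathbf{y}_{\mathrm{c}}\right)^{1/2}+\bar{\mathbf{r}}^\top\left|\mathbf{C}^{-1}\mathbf{c}_{\mathbf{Z}}(z)\right|+\left|\mathbf{y}_{\mathrm{c}}^\top\mathbf{Q}_J^{-1}\mathbf{c}_{\mathbf{Z}}(z)\right|,$$ $$P_J(z):=\left(c(z,z)-\mathbf{c}_{\mathbf{Z}}(z)^\top\mathbf{C}^{-1}\mathbf{c}_{\mathbf{Z}}(z)\right)^{1/2},\qquad \Delta_J:=\max_{\mathbf{q}\in\mathbb{R}^J,\ |\mathbf{q}|\le\bar{\mathbf{r}}}\left(-\mathbf{q}^\top\mathbf{C}^{-1}\mathbf{q}+2\mathbf{y}_{\mathrm{c}}^\top\mathbf{C}^{-1}\mathbf{q}\right),$$ $$\mathbf{Q}_J:=\mathbf{C}+(J\gamma)^{-1}\mathbf{C}^2=\mathbf{C}+(\delta^{*2})^{-1}\mathbf{C}^2,$$ the constraint $|\mathbf q|\le\bar{\mathbf r}$ and the absolute value of the vector $\mathbf{C}^{-1}\mathbf{c}_{\mathbf{Z}}(z)$ being componentwise.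
   Context: Discretization. $D\subset\mathbb{R}^d$ is a bounded domain; the problem is $-\nabla\cdot(\kappa\nabla u)=f$ in $D$, $u=0$ on $\partial D$, with a heterogeneous high-contrast coefficient $\kappa$. $\mathcal{T}^H$ is a conforming coarse partition of $D$ with mesh size $H$ and coarse nodes $x_1,\dots,x_N$; the coarse neighborhood $\omega_i$ is the union of the coarse elements $K\in\mathcal{T}^H$ with $x_i\in\overline K$. $V$ is the conforming piecewise-linear finite element space with homogeneous boundary condition on a conforming refinement $\mathcal{T}^h$ of $\mathcal{T}^H$. Put $a(v,w)=\int_D\kappa\nabla v\cdot\nabla w\,dx$ and $(f,v)=\int_D fv\,dx$. Offline basis. The local snapshot space $V_{\mathrm{snap}}^{\omega_i}$ is spanned by the fine-grid $\kappa$-harmonic extensions into $\omega_i$ of the discrete delta functions at the $L_i$ fine nodes of $\partial\omega_i$. The multiscale partition-of-unity function $\chi_i$ solves, on each coarse element $K\subset\omega_i$, $-\nabla\cdot(\kappa\nabla\chi_i)=0$ in $K$, with boundary values on $\partial K$ equal to the continuous piecewise-linear coarse nodal function that is $1$ at $x_i$ and $0$ at the other vertices of $K$. Let $(\lambda_k^{\omega_i},\phi_k^{\omega_i})$, $0<\lambda_1^{\omega_i}\le\dots\le\lambda_{L_i}^{\omega_i}$, be the eigenpairs in $V_{\mathrm{snap}}^{\omega_i}$ of $\int_{\omega_i}\kappa\nabla\phi\cdot\nabla\varphi\,dx=\lambda\int_{\omega_i}\widetilde\kappa\,\phi\varphi\,dx$ for all $\varphi\in V_{\mathrm{snap}}^{\omega_i}$,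 where $\widetilde\kappa=\kappa\sum_{r=1}^N H^2|\nabla\chi_r|^2$. The offline basis functions are $\psi_k^{\omega_i}=\chi_i\phi_k^{\omega_i}$. Exact indicators. At level $m$, $V_{\mathrm{off}}^m$ is the span of $\psi_k^{\omega_i}$, $1\le k\le l_i^m$, $1\le i\le N$, and $u_{\mathrm{ms}}^m\in V_{\mathrm{off}}^m$ solves $a(u_{\mathrm{ms}}^m,v)=(f,v)$ for all $v\in V_{\mathrm{off}}^m$. With $V_i=H_0^1(\omega_i)\cap V$, $\|v\|_{V_i}^2=\int_{\omega_i}\kappa|\nabla v|^2dx$, and $R_{m,i}(v)=\int_{\omega_i}fv\,dx-\int_{\omega_i}\kappa\nabla u_{\mathrm{ms}}^m\cdot\nabla v\,dx$ for $v\in V_i$, the exact indicator is $\eta_{m,i}^2=\|R_{m,i}\|_{V_i^*}^2\,(\lambda_{l_i^m+1}^{\omega_i})^{-1}$, where $\|\cdot\|_{V_i^*}$ is the dual norm of $\|\cdot\|_{V_i}$. Features and discrepancy. The feature vector of $(\omega_i,m)$ is $\mathbf{z}_{m,i}=(\|u_{\mathrm{ms}}^m\|_{L^2(\omega_i)},\ \|u_{\mathrm{ms}}^m-u_{\mathrm{ms}}^{m-1}\|_{L^2(\omega_i)},\ \lambda_{l_i^m+1}^{\omega_i},\ l_i^m,\ x_i^\top)^\top\in\mathbb{R}^{d_f}$, $d_f=4+d$, where $u_{\mathrm{ms}}^0$ is a fixed initialization state. Relative to the distribution of coefficient fields and adaptive states used for offline sampling, $(Z,Y)$ denotes the random feature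 vector and its exact indicator value; $m_\star(z)=\mathbb{E}[Y\mid Z=z]$ (a fixed function on the feature domain $\mathcal Z$, which contains all training and online feature vectors), and the discrepancy is $r=Y-m_\star(Z)$. For an online state, $Y_{m,i}=\eta_{m,i}^2$ and $r_{m,i}:=\eta_{m,i}^2-m_\star(\mathbf{z}_{m,i})$. Training data and predictor. The training set consists of $J$ pairs $(\mathbf{z}_j,y_j)$, realizations of $(Z,Y)$; $\mathbf{Z}=(\mathbf{z}_1,\dots,\mathbf{z}_J)^\top$, $\mathbf{y}=(y_1,\dots,y_J)^\top$, $\mathbf{r}=(y_j-m_\star(\mathbf{z}_j))_{j=1}^J$, $\mathbf{1}_J$ is the all-ones vector, $c(\mathbf{Z},\mathbf{Z})=[c(\mathbf{z}_j,\mathbf{z}_k)]_{j,k}$, $c(\mathbf{Z},z)=(c(\mathbf{z}_j,z))_j$, and $f_\star(\mathbf{Z})=(f_\star(\mathbf{z}_j))_j$. The fitted kernel $c$ is a Mat\'ern kernel $c_{3/2}(z,z')=\sigma^2(1+\sqrt3 t)e^{-\sqrt3 t}$ or $c_{5/2}(z,z')=\sigma^2(1+\sqrt5 t+\tfrac53t^2)e^{-\sqrt5 t}$, $t=\sqrt{(z-z')^\top\mathrm{diag}(\boldsymbol\beta)(z-z')}$, with fitted $\boldsymbol\beta\in\mathbb{R}_+^{d_f}$ and $\sigma^2$; $\zeta^*\in\mathbb{R}$ is the fitted constant prior mean and $\delta^{*2}$ the fitted nugget (all fitted by minimizing the negative log marginal likelihood of $\mathbf y$ under a Gaussian with mean $\zeta\mathbf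 1_J$ and covariance $c(\mathbf Z,\mathbf Z)+\delta^2\mathbf I_J$). The fitted posterior-mean predictor is $$s^\star(z):=\zeta^*+\mathbf{y}_{\mathrm{c}}^\top(\mathbf{C}+\delta^{*2}\mathbf{I}_J)^{-1}c(\mathbf{Z},z),\qquad z\in\mathcal{Z};$$ $s^\star-\zeta^*$ is the kernel ridge regression estimator for the centered data $\mathbf{y}_{\mathrm c}$ with objective $J^{-1}\sum_j((\mathbf y_{\mathrm c})_j-s(\mathbf{z}_j))^2+\gamma\|s\|_{\mathcal{H}_c}^2$ over $s\in\mathcal{H}_c$. The surrogate score is $\tilde\eta_{m,i}^2:=s^\star(\mathbf{z}_{m,i})$ (a real number; the superscript $2$ is only notation). *)

theory Defs
  imports "HOL-Probability.Probability"
begin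

section \<open>Sobolev spaces\<close>

text \<open>Functions on subsets of $d$-space are represented by functions on the whole type; only their
  values (up to null sets) on the domain in question matter.  Test functions are
  compactly supported functions of class $C^1$, which yield the same weak gradients and the same
  space $H_0^1$ as smooth ones.\<close>

definition square_integrable_on ::
  "(real^'d::finite \<Rightarrow> 'b::{banach,second_countable_topology}) \<Rightarrow> (real^'d) set \<Rightarrow> bool" where
  "square_integrable_on u S \<longleftrightarrow>
     set_borel_measurable lebesgue S u \<and> set_integrable lebesgue S (\<lambda>x. (norm (u x))\<^sup>2)"

definition L2_norm_on :: "(real^'d::finite) set \<Rightarrow> (real^'d \<Rightarrow> real) \<Rightarrow> real" where
  "L2_norm_on S u = sqrt (LINT x:S|lebesgue. (u x)\<^sup>2)"

definition test_function ::
  "(real^'d::finite) set \<Rightarrow> (real^'d \<Rightarrow> real) \<Rightarrow> (real^'d \<Rightarrow> real^'d) \<Rightarrow> bool" where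
  "test_function S p Dp \<longleftrightarrow>
     (\<exists>K. compact K \<and> K \<subseteq> S \<and> (\<forall>x. x \<notin> K \<longrightarrow> p x = 0)) \<and>
     (\<forall>x. GDERIV p x :> Dp x) \<and> continuous_on UNIV Dp"

definition weak_gradient ::
  "(real^'d::finite) set \<Rightarrow> (real^'d \<Rightarrow> real) \<Rightarrow> (real^'d \<Rightarrow> real^'d) \<Rightarrow> bool" where
  "weak_gradient S u g \<longleftrightarrow>
     (\<forall>K. compact K \<and> K \<subseteq> S \<longrightarrow> set_integrable lebesgue K u \<and> set_integrable lebesgue K g) \<and>
     (\<forall>p Dp. test_function S p Dp \<longrightarrow>
        (LINT x:S|lebesgue. u x *\<^sub>R Dp x) = - (LINT x:S|lebesgue. p x *\<^sub>R g x))"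

text \<open>A weak gradient on an open set is unique up to null sets, so integrals do not depend on the choice.\<close>

definition grad :: "(real^'d::finite) set \<Rightarrow> (real^'d \<Rightarrow> real) \<Rightarrow> real^'d \<Rightarrow> real^'d" where
  "grad S u = (SOME g. weak_gradient S u g)"

definition H10 :: "(real^'d::finite) set \<Rightarrow> (real^'d \<Rightarrow> real) set" where
  "H10 S = {u. square_integrable_on u S \<and>
     (\<exists>g. weak_gradient S u g \<and> square_integrable_on g S \<and>
        (\<exists>p Dp. (\<forall>n::nat. test_function S (p n) (Dp n)) \<and>
           (\<lambda>n. (LINT x:S|lebesgue. (u x - p n x)\<^sup>2) + (LINT x:S|lebesgue. (norm (g x - Dp n x))\<^sup>2))
             \<longlonglongrightarrow> 0))}"

text \<open>The bilinear form $\int_S \kappa \nabla v\cdot\nabla w$; the sets \<open>S\<close> used below are open sets or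
  finite unions of polytopes, so that \<open>S\<close> and its interior differ by a null set.\<close>

definition energy ::
  "(real^'d::finite \<Rightarrow> real) \<Rightarrow> (real^'d) set \<Rightarrow> (real^'d \<Rightarrow> real) \<Rightarrow> (real^'d \<Rightarrow> real) \<Rightarrow> real" where
  "energy \<kappa> S v w = (LINT x:S|lebesgue. \<kappa> x * (grad (interior S) v x \<bullet> grad (interior S) w x))"

definition admissible_coefficient :: "(real^'d::finite) set \<Rightarrow> (real^'d \<Rightarrow> real) \<Rightarrow> bool" where
  "admissible_coefficient D \<kappa> \<longleftrightarrow>
     set_borel_measurable lebesgue D \<kappa> \<and> (\<exists>a b. 0 < a \<and> (\<forall>x\<in>D. a \<le> \<kappa> x \<and> \<kappa> x \<le> b))"


section \<open>Meshes and finite element spaces\<close>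

record ('d::finite) mesh =
  region :: "(real^'d) set"
  coarse_mesh :: "(real^'d) set set"
  fine_mesh :: "(real^'d) set set"
  num_nodes :: nat
  node :: "nat \<Rightarrow> real^'d"

definition vertices :: "(real^'d::finite) set set \<Rightarrow> (real^'d) set" where
  "vertices T = {v. \<exists>K\<in>T. v extreme_point_of K}"

text \<open>Coarse elements are closed polytopes meeting face to face; their facets are
  simplices (this covers simplicial meshes and, for $d=2$, all polygonal ones), which is
  what makes the piecewise linear nodal functions on element boundaries well defined.
  The nodes include all coarse vertices in the open domain; vertices on its boundary may be
  counted as nodes or not.\<close>

definition wf_mesh :: "('d::finite) mesh \<Rightarrow> bool" where
  "wf_mesh M \<longleftrightarrow>
     open (region M) \<and> connected (region M) \<and> bounded (region M) \<and> region M \<noteq> {} \<and>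
     finite (coarse_mesh M) \<and> \<Union>(coarse_mesh M) = closure (region M) \<and>
     region M = interior (\<Union>(coarse_mesh M)) \<and>
     (\<forall>K\<in>coarse_mesh M. polytope K \<and> interior K \<noteq> {} \<and>
        (\<forall>F. F facet_of K \<longrightarrow> (\<exists>n. n simplex F))) \<and>
     (\<forall>K\<in>coarse_mesh M. \<forall>K'\<in>coarse_mesh M. (K \<inter> K') face_of K) \<and>
     triangulation (fine_mesh M) \<and> (\<forall>T\<in>fine_mesh M. int CARD('d) simplex T) \<and>
     \<Union>(fine_mesh M) = closure (region M) \<and> (\<forall>T\<in>fine_mesh M. \<exists>K\<in>coarse_mesh M. T \<subseteq> K) \<and>
     inj_on (node M) {1..num_nodes M} \<and>
     vertices (coarse_mesh M) \<inter> region M \<subseteq> node M ` {1..num_nodes M} \<and>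
     node M ` {1..num_nodes M} \<subseteq> vertices (coarse_mesh M)"

definition mesh_size :: "('d::finite) mesh \<Rightarrow> real" where
  "mesh_size M = Max (diameter ` coarse_mesh M)"

definition nbhd :: "('d::finite) mesh \<Rightarrow> nat \<Rightarrow> (real^'d) set" where
  "nbhd M i = \<Union>{K \<in> coarse_mesh M. node M i \<in> K}"

definition affine_function_on :: "(real^'d::finite) set \<Rightarrow> (real^'d \<Rightarrow> real) \<Rightarrow> bool" where
  "affine_function_on T v \<longleftrightarrow> (\<exists>a b. \<forall>x\<in>T. v x = a \<bullet> x + b)"

definition pl_space :: "('d::finite) mesh \<Rightarrow> (real^'d) set \<Rightarrow> (real^'d \<Rightarrow> real) set" where
  "pl_space M W = {v. continuous_on W v \<and> (\<forall>T\<in>fine_mesh M. T \<subseteq> W \<longrightarrow> affine_function_on T v) \<and>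
     (\<forall>x. x \<notin> W \<longrightarrow> v x = 0)}"

definition fe_space :: "('d::finite) mesh \<Rightarrow> (real^'d \<Rightarrow> real) set" where
  "fe_space M = {v \<in> pl_space M (closure (region M)). \<forall>x\<in>frontier (region M). v x = 0}"

text \<open>$V_i = H_0^1(\omega_i)\cap V$, elements of $H_0^1(\omega_i)$ being extended by zero.\<close>

definition local_fe_space :: "('d::finite) mesh \<Rightarrow> nat \<Rightarrow> (real^'d \<Rightarrow> real) set" where
  "local_fe_space M i =
     {v \<in> fe_space M. v \<in> H10 (interior (nbhd M i)) \<and> (\<forall>x. x \<notin> nbhd M i \<longrightarrow> v x = 0)}"

definition function_span :: "('a \<Rightarrow> real) set \<Rightarrow> ('a \<Rightarrow> real) set" where
  "function_span S = {v. \<exists>F a. finite F \<and> F \<subseteq> S \<and> v = (\<lambda>x. \<Sum>s\<in>F. a s * s x)}"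


section \<open>The multiscale method\<close>

definition boundary_nodes :: "('d::finite) mesh \<Rightarrow> nat \<Rightarrow> (real^'d) set" where
  "boundary_nodes M i = vertices (fine_mesh M) \<inter> frontier (nbhd M i)"

definition is_snapshot ::
  "('d::finite) mesh \<Rightarrow> (real^'d \<Rightarrow> real) \<Rightarrow> nat \<Rightarrow> real^'d \<Rightarrow> (real^'d \<Rightarrow> real) \<Rightarrow> bool" where
  "is_snapshot M \<kappa> i b s \<longleftrightarrow>
     s \<in> pl_space M (nbhd M i) \<and>
     (\<forall>b'\<in>boundary_nodes M i. s b' = (if b' = b then 1 else 0)) \<and>
     (\<forall>v\<in>pl_space M (nbhd M i). (\<forall>x\<in>frontier (nbhd M i). v x = 0) \<longrightarrow> energy \<kappa> (nbhd M i) s v = 0)"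

definition snapshot_space ::
  "('d::finite) mesh \<Rightarrow> (real^'d \<Rightarrow> real) \<Rightarrow> nat \<Rightarrow> (real^'d \<Rightarrow> real) set" where
  "snapshot_space M \<kappa> i = function_span {s. \<exists>b\<in>boundary_nodes M i. is_snapshot M \<kappa> i b s}"

text \<open>\<open>G\<close> is any Lipschitz extension into \<open>K\<close> of the piecewise linear nodal function on the
  boundary of \<open>K\<close>; the Dirichlet condition for \<open>\<xi>\<close> is \<open>\<xi> - G \<in> H10 (interior K)\<close>.\<close>

definition nodal_extension ::
  "(real^'d::finite) set \<Rightarrow> real^'d \<Rightarrow> (real^'d \<Rightarrow> real) \<Rightarrow> bool" where
  "nodal_extension K x G \<longleftrightarrow>
     (\<exists>L. L-lipschitz_on K G) \<and> (\<forall>F. F facet_of K \<longrightarrow> affine_function_on F G) \<and>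
     (\<forall>v. v extreme_point_of K \<longrightarrow> G v = (if v = x then 1 else 0))"

definition is_partition_function ::
  "('d::finite) mesh \<Rightarrow> (real^'d \<Rightarrow> real) \<Rightarrow> nat \<Rightarrow> (real^'d \<Rightarrow> real) \<Rightarrow> bool" where
  "is_partition_function M \<kappa> i \<xi> \<longleftrightarrow>
     (\<forall>x. x \<notin> nbhd M i \<longrightarrow> \<xi> x = 0) \<and>
     (\<forall>K\<in>coarse_mesh M. node M i \<in> K \<longrightarrow>
        (\<exists>G. nodal_extension K (node M i) G \<and> (\<lambda>x. \<xi> x - G x) \<in> H10 (interior K)) \<and>
        (\<forall>v\<in>H10 (interior K). energy \<kappa> K \<xi> v = 0))"

definition kappa_tilde ::
  "('d::finite) mesh \<Rightarrow> (real^'d \<Rightarrow> real) \<Rightarrow> (nat \<Rightarrow> real^'d \<Rightarrow> real) \<Rightarrow> real^'d \<Rightarrow> real" where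
  "kappa_tilde M \<kappa> \<xi> x =
     \<kappa> x * (\<Sum>r=1..num_nodes M. (mesh_size M)\<^sup>2 * (norm (grad (region M) (\<xi> r) x))\<^sup>2)"

text \<open>The eigenpairs, listed with multiplicity.  Constants belong to the snapshot space,
  so the smallest eigenvalue is allowed to be zero; positivity
  is required (in \<open>online_state\<close>) of the eigenvalues by which the indicators divide.\<close>

definition are_eigenpairs ::
  "('d::finite) mesh \<Rightarrow> (real^'d \<Rightarrow> real) \<Rightarrow> (nat \<Rightarrow> real^'d \<Rightarrow> real) \<Rightarrow> nat \<Rightarrow>
     (nat \<Rightarrow> real) \<Rightarrow> (nat \<Rightarrow> real^'d \<Rightarrow> real) \<Rightarrow> bool" where
  "are_eigenpairs M \<kappa> \<xi> i \<mu> \<phi> \<longleftrightarrow>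
     (let L = card (boundary_nodes M i) in
       (\<forall>k\<in>{1..L}. \<phi> k \<in> snapshot_space M \<kappa> i \<and> 0 \<le> \<mu> k \<and>
          (\<forall>v\<in>snapshot_space M \<kappa> i. energy \<kappa> (nbhd M i) (\<phi> k) v =
             \<mu> k * (LINT x:nbhd M i|lebesgue. kappa_tilde M \<kappa> \<xi> x * \<phi> k x * v x))) \<and>
       (\<forall>j\<in>{1..L}. \<forall>k\<in>{1..L}. j \<le> k \<longrightarrow> \<mu> j \<le> \<mu> k) \<and>
       (\<forall>a. (\<forall>x. (\<Sum>k=1..L. a k * \<phi> k x) = 0) \<longrightarrow> (\<forall>k\<in>{1..L}. a k = 0)))"

text \<open>\<open>num_basis m i\<close> is $l_i^m$, and \<open>sol m\<close> is $u_{\mathrm{ms}}^m$ for levels \<open>1 \<le> m \<le> levels\<close>,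
  \<open>sol 0\<close> being the initialization state.\<close>

record ('d::finite) ms_run =
  coeff :: "real^'d \<Rightarrow> real"
  pou :: "nat \<Rightarrow> real^'d \<Rightarrow> real"
  eigval :: "nat \<Rightarrow> nat \<Rightarrow> real"
  eigfun :: "nat \<Rightarrow> nat \<Rightarrow> real^'d \<Rightarrow> real"
  levels :: nat
  num_basis :: "nat \<Rightarrow> nat \<Rightarrow> nat"
  sol :: "nat \<Rightarrow> real^'d \<Rightarrow> real"

definition offline_space :: "('d::finite) mesh \<Rightarrow> 'd ms_run \<Rightarrow> nat \<Rightarrow> (real^'d \<Rightarrow> real) set" where
  "offline_space M R m = function_span
     {\<lambda>x. pou R i x * eigfun R i k x | i k. i \<in> {1..num_nodes M} \<and> k \<in> {1..num_basis R m i}}"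

definition is_ms_run ::
  "('d::finite) mesh \<Rightarrow> (real^'d \<Rightarrow> real) \<Rightarrow> (real^'d \<Rightarrow> real) \<Rightarrow> 'd ms_run \<Rightarrow> bool" where
  "is_ms_run M f u0 R \<longleftrightarrow>
     admissible_coefficient (region M) (coeff R) \<and>
     (\<forall>i\<in>{1..num_nodes M}. is_partition_function M (coeff R) i (pou R i)) \<and>
     (\<forall>i\<in>{1..num_nodes M}. are_eigenpairs M (coeff R) (pou R) i (eigval R i) (eigfun R i)) \<and>
     (\<forall>m\<in>{1..levels R}. \<forall>i\<in>{1..num_nodes M}. num_basis R m i \<le> card (boundary_nodes M i)) \<and>
     sol R 0 = u0 \<and>
     (\<forall>m\<in>{1..levels R}. sol R m \<in> offline_space M R m \<and>
        (\<forall>v\<in>offline_space M R m.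
           energy (coeff R) (region M) (sol R m) v = (LINT x:region M|lebesgue. f x * v x)))"

definition online_state :: "('d::finite) mesh \<Rightarrow> 'd ms_run \<Rightarrow> nat \<Rightarrow> nat \<Rightarrow> bool" where
  "online_state M R m i \<longleftrightarrow>
     m \<in> {1..levels R} \<and> i \<in> {1..num_nodes M} \<and>
     num_basis R m i < card (boundary_nodes M i) \<and> 0 < eigval R i (num_basis R m i + 1)"

definition residual ::
  "('d::finite) mesh \<Rightarrow> (real^'d \<Rightarrow> real) \<Rightarrow> 'd ms_run \<Rightarrow> nat \<Rightarrow> nat \<Rightarrow> (real^'d \<Rightarrow> real) \<Rightarrow> real" where
  "residual M f R m i v =
     (LINT x:nbhd M i|lebesgue. f x * v x) - energy (coeff R) (nbhd M i) (sol R m) v"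

definition local_dual_norm ::
  "('d::finite) mesh \<Rightarrow> (real^'d \<Rightarrow> real) \<Rightarrow> nat \<Rightarrow> ((real^'d \<Rightarrow> real) \<Rightarrow> real) \<Rightarrow> real" where
  "local_dual_norm M \<kappa> i \<rho> =
     Sup {\<bar>\<rho> v\<bar> | v. v \<in> local_fe_space M i \<and> sqrt (energy \<kappa> (nbhd M i) v v) \<le> 1}"

text \<open>The squared indicator $\eta_{m,i}^2$.\<close>

definition indicator_sq ::
  "('d::finite) mesh \<Rightarrow> (real^'d \<Rightarrow> real) \<Rightarrow> 'd ms_run \<Rightarrow> nat \<Rightarrow> nat \<Rightarrow> real" where
  "indicator_sq M f R m i =
     (local_dual_norm M (coeff R) i (residual M f R m i))\<^sup>2 * inverse (eigval R i (num_basis R m i + 1))"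

definition feature :: "('d::finite) mesh \<Rightarrow> 'd ms_run \<Rightarrow> nat \<Rightarrow> nat \<Rightarrow> real^(4 + 'd)" where
  "feature M R m i = (\<chi> k. case k of
     Inl a \<Rightarrow> (vector [L2_norm_on (nbhd M i) (sol R m),
                       L2_norm_on (nbhd M i) (\<lambda>x. sol R m x - sol R (m - 1) x),
                       eigval R i (num_basis R m i + 1),
                       real (num_basis R m i)] :: real^4) $ a
   | Inr j \<Rightarrow> node M i $ j)"


section \<open>Kernels and reproducing kernel Hilbert spaces\<close>

definition scaled_dist :: "real^'f::finite \<Rightarrow> real^'f \<Rightarrow> real^'f \<Rightarrow> real" where
  "scaled_dist \<beta> z z' = sqrt ((z - z') \<bullet> (\<chi> k. \<beta> $ k * (z - z') $ k))"

definition matern32 :: "real \<Rightarrow> real^'f::finite \<Rightarrow> real^'f \<Rightarrow> real^'f \<Rightarrow> real" where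
  "matern32 \<sigma>2 \<beta> z z' = (let t = scaled_dist \<beta> z z' in \<sigma>2 * (1 + sqrt 3 * t) * exp (- sqrt 3 * t))"

definition matern52 :: "real \<Rightarrow> real^'f::finite \<Rightarrow> real^'f \<Rightarrow> real^'f \<Rightarrow> real" where
  "matern52 \<sigma>2 \<beta> z z' =
     (let t = scaled_dist \<beta> z z' in \<sigma>2 * (1 + sqrt 5 * t + 5 / 3 * t\<^sup>2) * exp (- sqrt 5 * t))"

definition positive_definite_kernel_on :: "'a set \<Rightarrow> ('a \<Rightarrow> 'a \<Rightarrow> real) \<Rightarrow> bool" where
  "positive_definite_kernel_on Z c \<longleftrightarrow>
     (\<forall>x\<in>Z. \<forall>y\<in>Z. c x y = c y x) \<and>
     (\<forall>F a. finite F \<and> F \<subseteq> Z \<and> (\<exists>x\<in>F. a x \<noteq> 0) \<longrightarrow> 0 < (\<Sum>x\<in>F. \<Sum>y\<in>F. a x * a y * c x y))"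

text \<open>The reproducing kernel Hilbert space of \<open>c\<close> on \<open>Z\<close>, with elements represented as
  extensional functions; by the Moore-Aronszajn theorem \<open>H\<close> and \<open>ip\<close> (on \<open>H\<close>) are determined by \<open>Z\<close> and \<open>c\<close>.\<close>

locale rkhs =
  fixes Z :: "'a set" and c :: "'a \<Rightarrow> 'a \<Rightarrow> real"
    and H :: "('a \<Rightarrow> real) set" and ip :: "('a \<Rightarrow> real) \<Rightarrow> ('a \<Rightarrow> real) \<Rightarrow> real"
  assumes extensional: "H \<subseteq> extensional Z"
    and zero_mem: "(\<lambda>z\<in>Z. 0) \<in> H"
    and lincomb_mem: "\<lbrakk>f \<in> H; g \<in> H\<rbrakk> \<Longrightarrow> (\<lambda>z\<in>Z. a * f z + b * g z) \<in> H"
    and ip_sym: "\<lbrakk>f \<in> H; g \<in> H\<rbrakk> \<Longrightarrow> ip f g = ip g f"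
    and ip_lincomb: "\<lbrakk>f \<in> H; g \<in> H; h \<in> H\<rbrakk> \<Longrightarrow>
      ip (\<lambda>z\<in>Z. a * f z + b * g z) h = a * ip f h + b * ip g h"
    and ip_nonneg: "f \<in> H \<Longrightarrow> 0 \<le> ip f f"
    and ip_definite: "\<lbrakk>f \<in> H; ip f f = 0\<rbrakk> \<Longrightarrow> f = (\<lambda>z\<in>Z. 0)"
    and complete: "\<lbrakk>\<And>n::nat. F n \<in> H;
        \<And>e. e > 0 \<Longrightarrow> \<exists>n0. \<forall>m\<ge>n0. \<forall>n\<ge>n0.
          sqrt (ip (\<lambda>z\<in>Z. F m z - F n z) (\<lambda>z\<in>Z. F m z - F n z)) < e\<rbrakk> \<Longrightarrow>
      \<exists>g\<in>H. (\<lambda>n. sqrt (ip (\<lambda>z\<in>Z. F n z - g z) (\<lambda>z\<in>Z. F n z - g z))) \<longlonglongrightarrow> 0"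
    and section_mem: "z \<in> Z \<Longrightarrow> (\<lambda>w\<in>Z. c w z) \<in> H"
    and reproducing: "\<lbrakk>z \<in> Z; f \<in> H\<rbrakk> \<Longrightarrow> ip f (\<lambda>w\<in>Z. c w z) = f z"


section \<open>The fitted predictor and its error bound\<close>

text \<open>The training sites are the rows of the matrix \<open>Zs\<close>; $J$ is \<open>CARD('j)\<close>.\<close>

definition gram :: "('a \<Rightarrow> 'a \<Rightarrow> real) \<Rightarrow> 'a^'j::finite \<Rightarrow> real^'j^'j" where
  "gram c Zs = (\<chi> j k. c (Zs $ j) (Zs $ k))"

definition cross :: "('a \<Rightarrow> 'a \<Rightarrow> real) \<Rightarrow> 'a^'j::finite \<Rightarrow> 'a \<Rightarrow> real^'j" where
  "cross c Zs z = (\<chi> j. c (Zs $ j) z)"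

definition abs_vec :: "real^'j::finite \<Rightarrow> real^'j" where
  "abs_vec v = (\<chi> j. \<bar>v $ j\<bar>)"

text \<open>Negative log marginal likelihood of \<open>y\<close> under the Gaussian with mean \<open>vec \<zeta>\<close> and
  covariance \<open>gram c Zs + \<delta>2 I\<close>.\<close>

definition neg_log_likelihood ::
  "('a \<Rightarrow> 'a \<Rightarrow> real) \<Rightarrow> 'a^'j::finite \<Rightarrow> real^'j \<Rightarrow> real \<Rightarrow> real \<Rightarrow> real" where
  "neg_log_likelihood c Zs y \<zeta> \<delta>2 =
     (let S = gram c Zs + \<delta>2 *\<^sub>R mat 1 in
       ((y - vec \<zeta>) \<bullet> (matrix_inv S *v (y - vec \<zeta>)) + ln (det S) + real CARD('j) * ln (2 * pi)) / 2)"

definition admissible_parameters ::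
  "(real \<Rightarrow> real^'f::finite \<Rightarrow> real^'f \<Rightarrow> real^'f \<Rightarrow> real) \<Rightarrow> (real^'f)^'j::finite \<Rightarrow>
     real \<Rightarrow> real^'f \<Rightarrow> real \<Rightarrow> bool" where
  "admissible_parameters fam Zs \<sigma>2 \<beta> \<delta>2 \<longleftrightarrow>
     0 < \<sigma>2 \<and> (\<forall>k. 0 \<le> \<beta> $ k) \<and> 0 \<le> \<delta>2 \<and> 0 < det (gram (fam \<sigma>2 \<beta>) Zs + \<delta>2 *\<^sub>R mat 1)"

definition fitted_parameters ::
  "(real \<Rightarrow> real^'f::finite \<Rightarrow> real^'f \<Rightarrow> real^'f \<Rightarrow> real) \<Rightarrow> (real^'f)^'j::finite \<Rightarrow> real^'j \<Rightarrow>
     real \<Rightarrow> real^'f \<Rightarrow> real \<Rightarrow> real \<Rightarrow> bool" where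
  "fitted_parameters fam Zs y \<sigma>2 \<beta> \<zeta> \<delta>2 \<longleftrightarrow>
     admissible_parameters fam Zs \<sigma>2 \<beta> \<delta>2 \<and>
     (\<forall>\<sigma>2' \<beta>' \<zeta>' \<delta>2'. admissible_parameters fam Zs \<sigma>2' \<beta>' \<delta>2' \<longrightarrow>
        neg_log_likelihood (fam \<sigma>2 \<beta>) Zs y \<zeta> \<delta>2 \<le> neg_log_likelihood (fam \<sigma>2' \<beta>') Zs y \<zeta>' \<delta>2')"

definition posterior_mean ::
  "('a \<Rightarrow> 'a \<Rightarrow> real) \<Rightarrow> 'a^'j::finite \<Rightarrow> real^'j \<Rightarrow> real \<Rightarrow> real \<Rightarrow> 'a \<Rightarrow> real" where
  "posterior_mean c Zs y \<zeta> \<delta>2 z =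
     \<zeta> + (y - vec \<zeta>) \<bullet> (matrix_inv (gram c Zs + \<delta>2 *\<^sub>R mat 1) *v cross c Zs z)"

definition power_function :: "('a \<Rightarrow> 'a \<Rightarrow> real) \<Rightarrow> 'a^'j::finite \<Rightarrow> 'a \<Rightarrow> real" where
  "power_function c Zs z =
     sqrt (c z z - cross c Zs z \<bullet> (matrix_inv (gram c Zs) *v cross c Zs z))"

text \<open>$\Delta_J$ for centered data \<open>yc\<close>; the supremum is a maximum, see \<open>discrepancy_max_attained\<close>.\<close>

definition discrepancy_max ::
  "('a \<Rightarrow> 'a \<Rightarrow> real) \<Rightarrow> 'a^'j::finite \<Rightarrow> real^'j \<Rightarrow> real^'j \<Rightarrow> real" where
  "discrepancy_max c Zs yc rbar =
     (SUP q\<in>{q. \<forall>j. \<bar>q $ j\<bar> \<le> rbar $ j}.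
        - (q \<bullet> (matrix_inv (gram c Zs) *v q)) + 2 * (yc \<bullet> (matrix_inv (gram c Zs) *v q)))"

lemma discrepancy_max_attained:
  fixes c :: "'a \<Rightarrow> 'a \<Rightarrow> real" and Zs :: "'a^'j::finite" and yc rbar :: "real^'j"
  assumes "\<And>j. 0 \<le> rbar $ j"
  defines "val \<equiv> \<lambda>q. - (q \<bullet> (matrix_inv (gram c Zs) *v q)) + 2 * (yc \<bullet> (matrix_inv (gram c Zs) *v q))"
  shows "\<exists>q. (\<forall>j. \<bar>q $ j\<bar> \<le> rbar $ j) \<and> val q = discrepancy_max c Zs yc rbar \<and>
           (\<forall>q'. (\<forall>j. \<bar>q' $ j\<bar> \<le> rbar $ j) \<longrightarrow> val q' \<le> val q)"
proof -
  let ?B = "{q. \<forall>j. \<bar>q $ j\<bar> \<le> rbar $ j}"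
  have "?B = cbox (- rbar) rbar"
    by (auto simp: mem_box_cart abs_le_iff minus_le_iff)
  then have comp: "compact ?B"
    by simp
  moreover have "0 \<in> ?B"
    using assms(1) by simp
  moreover have "continuous_on ?B val"
    unfolding val_def by (intro continuous_intros matrix_vector_mult_linear_continuous_on)
  ultimately obtain q where q: "q \<in> ?B" "\<And>q'. q' \<in> ?B \<Longrightarrow> val q' \<le> val q"
    using continuous_attains_sup[of ?B val] by blast
  then have "(SUP q\<in>?B. val q) = val q"
    by (intro cSup_eq_maximum) auto
  then show ?thesis
    using q unfolding discrepancy_max_def val_def by auto
qed

definition Q_matrix :: "('a \<Rightarrow> 'a \<Rightarrow> real) \<Rightarrow> 'a^'j::finite \<Rightarrow> real \<Rightarrow> real^'j^'j" where
  "Q_matrix c Zs \<gamma> = gram c Zs + inverse (real CARD('j) * \<gamma>) *\<^sub>R (gram c Zs ** gram c Zs)"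

definition krr_bound ::
  "('a \<Rightarrow> 'a \<Rightarrow> real) \<Rightarrow> 'a^'j::finite \<Rightarrow> real^'j \<Rightarrow> real^'j \<Rightarrow> real \<Rightarrow> real \<Rightarrow> 'a \<Rightarrow> real" where
  "krr_bound c Zs yc rbar \<Gamma> \<gamma> z =
     power_function c Zs z *
       sqrt (\<Gamma>\<^sup>2 + discrepancy_max c Zs yc rbar - yc \<bullet> (matrix_inv (gram c Zs) *v yc))
     + rbar \<bullet> abs_vec (matrix_inv (gram c Zs) *v cross c Zs z)
     + \<bar>yc \<bullet> (matrix_inv (Q_matrix c Zs \<gamma>) *v cross c Zs z)\<bar>"

end

theory Submission
  imports Defs
begin

text \<open>
  Let \<open>f\<close> be the centered target, \<open>f\<^sub>Z\<close> the vector of its values at the sites, \<open>b = cross c Zs z\<close>,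
  \<open>a = C\<inverse> b\<close>, and \<open>r = y\<^sub>c - f\<^sub>Z\<close> the discrepancies.  The centered prediction is
  \<open>y\<^sub>c \<bullet> (C + \<delta>2 I)\<inverse> b\<close>, and its error splits into three parts:
  \<open>f z - f\<^sub>Z \<bullet> a\<close>, the error of noise-free kernel interpolation; \<open>r \<bullet> a\<close>, the effect of the
  discrepancies on the interpolant; and \<open>y\<^sub>c \<bullet> (C\<inverse> - (C + \<delta>2 I)\<inverse>) b\<close>, the effect of the
  regularization.

  The first part carries the reproducing kernel argument (\<open>rkhs.interpolation_error\<close>).
  The function \<open>g = c(\<cdot>, z) - (\<Sum>j. a $ j * c(\<cdot>, z\<^sub>j))\<close> vanishes at all sites, so it is orthogonal to
  their kernel sections and in particular to the interpolant \<open>s\<close> of \<open>f\<close>.  Hence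
  \<open>f z - f\<^sub>Z \<bullet> a = \<langle>f, g\<rangle> = \<langle>f - s, g\<rangle>\<close>, and Cauchy-Schwarz bounds this by the power function
  \<open>\<parallel>g\<parallel>\<close> times \<open>\<parallel>f - s\<parallel>\<close>, where \<open>\<parallel>f - s\<parallel>\<^sup>2 = \<parallel>f\<parallel>\<^sup>2 - f\<^sub>Z \<bullet> C\<inverse> f\<^sub>Z\<close>.
  Since \<open>f\<^sub>Z\<close> is not observed, \<open>y\<^sub>c - r\<close> is substituted for it: expanding the quadratic form gives
  \<open>- (y\<^sub>c \<bullet> C\<inverse> y\<^sub>c)\<close> plus the objective of the discrepancy maximum at \<open>q = r\<close>.

  The second part is at most \<open>rbar \<bullet> \<bar>a\<bar>\<close> entrywise.  The third is an exact resolvent identity,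
  \<open>C\<inverse> - (C + \<delta>2 I)\<inverse> = Q\<inverse>\<close> (\<open>ridge_resolvent_difference\<close>).  Adding \<open>\<zeta>\<close> back turns this into
  a bound on the distance from the surrogate score to \<open>m_star z\<close>, and the distance from there to the
  exact indicator is the online discrepancy.
\<close>

section \<open>Matrix inverses and the ridge resolvent\<close>

lemma matrix_inv_mult_vector:
  fixes A :: "real^'n^'n"
  assumes "invertible A"
  shows "A *v (matrix_inv A *v x) = x" "matrix_inv A *v (A *v x) = x"
proof -
  have "A ** matrix_inv A = mat 1 \<and> matrix_inv A ** A = mat 1"
    using assms unfolding invertible_def matrix_inv_def by (rule someI_ex)
  then show "A *v (matrix_inv A *v x) = x" "matrix_inv A *v (A *v x) = x"
    by (simp_all add: matrix_vector_mul_assoc)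
qed

lemma invertible_if_kernel_trivial:
  fixes A :: "real^'n^'n"
  assumes "\<And>x. A *v x = 0 \<Longrightarrow> x = 0"
  shows "invertible A"
  using assms by (simp add: invertible_left_inverse matrix_left_invertible_ker)

lemma inner_symmetric_matrix:
  fixes A :: "real^'n^'n"
  assumes "\<And>j k. A $ j $ k = A $ k $ j"
  shows "x \<bullet> (A *v y) = y \<bullet> (A *v x)"
proof -
  have "transpose A = A"
    using assms by (simp add: transpose_def vec_eq_iff)
  then show ?thesis
    by (metis dot_lmul_matrix inner_commute vector_transpose_matrix)
qed

lemma inner_symmetric_matrix_inv:
  fixes A :: "real^'n^'n"
  assumes "\<And>j k. A $ j $ k = A $ k $ j" "invertible A"
  shows "x \<bullet> (matrix_inv A *v y) = y \<bullet> (matrix_inv A *v x)"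
proof -
  have "x \<bullet> (matrix_inv A *v y) = (A *v (matrix_inv A *v x)) \<bullet> (matrix_inv A *v y)"
    by (simp add: matrix_inv_mult_vector assms(2))
  also have "\<dots> = (matrix_inv A *v x) \<bullet> (A *v (matrix_inv A *v y))"
    using inner_symmetric_matrix[of A "matrix_inv A *v y" "matrix_inv A *v x"] assms(1)
    by (simp add: inner_commute)
  finally show ?thesis
    by (simp add: matrix_inv_mult_vector assms(2) inner_commute)
qed

text \<open>The matrix \<open>A + d\<inverse> A\<^sup>2\<close> is \<open>d\<inverse> A (A + d I)\<close> and its factors commute.  Applied to
  \<open>A\<inverse> x - (A + d I)\<inverse> x\<close> it therefore gives \<open>d\<inverse> ((A + d I) x - A x) = x\<close>.\<close>

lemma ridge_resolvent_difference:
  fixes A :: "real^'n^'n"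
  assumes A: "invertible A" and B: "invertible (A + d *\<^sub>R mat 1)" and d: "d \<noteq> 0"
  shows "matrix_inv A *v x - matrix_inv (A + d *\<^sub>R mat 1) *v x
    = matrix_inv (A + inverse d *\<^sub>R (A ** A)) *v x"
proof -
  let ?B = "A + d *\<^sub>R mat 1"
  let ?Q = "A + inverse d *\<^sub>R (A ** A)"
  let ?u = "matrix_inv A *v x" and ?v = "matrix_inv ?B *v x"
  have Bv: "?B *v y = A *v y + d *\<^sub>R y" for y
    by (simp add: matrix_vector_mult_add_rdistrib scaleR_matrix_vector_assoc[symmetric])
  have Qv: "?Q *v y = inverse d *\<^sub>R (A *v (?B *v y))" for y
    using d by (simp add: Bv matrix_vector_mult_add_rdistrib scaleR_matrix_vector_assoc[symmetric]
        matrix_vector_mul_assoc[symmetric] matrix_vector_right_distrib matrix_vector_mult_scaleR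
        scaleR_right_distrib)
  have commute: "A *v (?B *v y) = ?B *v (A *v y)" for y
    by (simp add: Bv matrix_vector_right_distrib matrix_vector_mult_scaleR)
  have Q: "invertible ?Q"
  proof (rule invertible_if_kernel_trivial)
    fix y assume "?Q *v y = 0"
    then have "A *v (?B *v y) = 0"
      using d by (simp add: Qv)
    then show "y = 0"
      by (metis A B matrix_inv_mult_vector(2) matrix_vector_mult_0_right)
  qed
  have "?Q *v ?u = inverse d *\<^sub>R (?B *v x)"
    by (simp add: Qv commute matrix_inv_mult_vector(1)[OF A])
  moreover have "?Q *v ?v = inverse d *\<^sub>R (A *v x)"
    by (simp add: Qv matrix_inv_mult_vector(1)[OF B])
  ultimately have "?Q *v (?u - ?v) = x"
    using d by (simp add: matrix_vector_mult_diff_distrib Bv scaleR_right_distrib)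
  then show ?thesis
    by (metis Q matrix_inv_mult_vector(2))
qed

section \<open>Gram matrices of positive definite kernels\<close>

text \<open>Distinct sites make the coefficients \<open>v $ j\<close> a function of the site \<open>Zs $ j\<close>, which is the form in which
  positive definiteness of the kernel applies.\<close>

lemma gram_positive_definite:
  fixes Zs :: "'a^'j::finite"
  assumes c: "positive_definite_kernel_on Z c" and Zs: "\<And>j. Zs $ j \<in> Z" "inj (($) Zs)"
    and v: "v \<noteq> 0"
  shows "0 < v \<bullet> (gram c Zs *v v)"
proof -
  let ?F = "range (($) Zs)" and ?a = "\<lambda>x. v $ (inv (($) Zs) x)"
  have a: "?a (Zs $ j) = v $ j" for j
    using Zs(2) by simp
  obtain j where "v $ j \<noteq> 0"
    using v by (auto simp: vec_eq_iff)
  then have nonzero: "finite ?F \<and> ?F \<subseteq> Z \<and> (\<exists>x\<in>?F. ?a x \<noteq> 0)"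
    using Zs(1) a by force
  have "finite F \<and> F \<subseteq> Z \<and> (\<exists>x\<in>F. a x \<noteq> 0) \<longrightarrow> 0 < (\<Sum>x\<in>F. \<Sum>y\<in>F. a x * a y * c x y)" for F a
    using conjunct2[OF c[unfolded positive_definite_kernel_on_def], THEN spec, THEN spec] .
  from this[of ?F ?a] nonzero have "0 < (\<Sum>x\<in>?F. \<Sum>y\<in>?F. ?a x * ?a y * c x y)"
    by (rule mp)
  also have "\<dots> = (\<Sum>j\<in>UNIV. \<Sum>k\<in>UNIV. v $ j * v $ k * c (Zs $ j) (Zs $ k))"
    by (simp only: sum.reindex[OF Zs(2)] o_def a)
  also have "\<dots> = v \<bullet> (gram c Zs *v v)"
    by (simp add: inner_vec_def matrix_vector_mult_def gram_def sum_distrib_left mult_ac)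
  finally show ?thesis .
qed

lemma invertible_gram_plus_ridge:
  fixes Zs :: "'a^'j::finite"
  assumes "positive_definite_kernel_on Z c" "\<And>j. Zs $ j \<in> Z" "inj (($) Zs)" "0 \<le> d"
  shows "invertible (gram c Zs + d *\<^sub>R mat 1)"
proof (rule invertible_if_kernel_trivial, rule ccontr)
  fix v assume "(gram c Zs + d *\<^sub>R mat 1) *v v = 0" and v: "v \<noteq> 0"
  then have "v \<bullet> (gram c Zs *v v) + d * (v \<bullet> v) = v \<bullet> 0"
    by (simp add: matrix_vector_mult_add_rdistrib scaleR_matrix_vector_assoc[symmetric]
        flip: inner_scaleR_right inner_add_right)
  moreover have "0 \<le> d * (v \<bullet> v)"
    using assms(4) by simp
  ultimately show False
    using gram_positive_definite[OF assms(1-3) v] by simp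
qed

section \<open>Kernel interpolation in a reproducing kernel Hilbert space\<close>

context rkhs
begin

lemma kernel_sym:
  assumes x: "x \<in> Z" and y: "y \<in> Z"
  shows "c x y = c y x"
proof -
  have "c x y = ip (\<lambda>w\<in>Z. c w y) (\<lambda>w\<in>Z. c w x)"
    using reproducing[OF x section_mem[OF y]] x by simp
  also have "\<dots> = ip (\<lambda>w\<in>Z. c w x) (\<lambda>w\<in>Z. c w y)"
    by (rule ip_sym[OF section_mem[OF y] section_mem[OF x]])
  also have "\<dots> = c y x"
    using reproducing[OF y section_mem[OF x]] y by simp
  finally show ?thesis .
qed

lemma diff_mem: "\<lbrakk>f \<in> H; g \<in> H\<rbrakk> \<Longrightarrow> (\<lambda>z\<in>Z. f z - g z) \<in> H"
  using lincomb_mem[of f g 1 "-1"] by simp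

lemma ip_diff_left:
  "\<lbrakk>f \<in> H; g \<in> H; h \<in> H\<rbrakk> \<Longrightarrow> ip (\<lambda>z\<in>Z. f z - g z) h = ip f h - ip g h"
  using ip_lincomb[of f g h 1 "-1"] by simp

lemma ip_diff_right:
  assumes f: "f \<in> H" and g: "g \<in> H" and h: "h \<in> H"
  shows "ip h (\<lambda>z\<in>Z. f z - g z) = ip h f - ip h g"
  unfolding ip_sym[OF h diff_mem[OF f g]] ip_sym[OF h f] ip_sym[OF h g]
  using f g h by (rule ip_diff_left)

lemma ip_zero_right: "f \<in> H \<Longrightarrow> ip f (\<lambda>z\<in>Z. 0) = 0"
  using ip_diff_right[of f f f] by simp

lemma Cauchy_Schwarz:
  assumes f: "f \<in> H" and g: "g \<in> H"
  shows "\<bar>ip f g\<bar> \<le> sqrt (ip f f) * sqrt (ip g g)"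
proof (cases "ip g g = 0")
  case True
  then show ?thesis
    using ip_definite[OF g] ip_zero_right[OF f] by simp
next
  case False
  then have pos: "0 < ip g g"
    using ip_nonneg[OF g] by simp
  \<comment> \<open>\<open>h\<close> is \<open>ip g g\<close> times the component of \<open>f\<close> orthogonal to \<open>g\<close>.\<close>
  define h where "h = (\<lambda>z\<in>Z. ip g g * f z + (- ip f g) * g z)"
  have h: "h \<in> H"
    unfolding h_def using f g by (rule lincomb_mem)
  have ip_h: "ip h k = ip g g * ip f k - ip f g * ip g k" if "k \<in> H" for k
    unfolding h_def using ip_lincomb[OF f g that, of "ip g g" "- ip f g"] by simp
  have "ip h h = ip g g * ip h f - ip f g * ip h g"
    using ip_h[OF h] ip_sym h f g by simp
  also have "\<dots> = ip g g * (ip f f * ip g g - (ip f g)\<^sup>2)"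
    unfolding ip_h[OF f] ip_h[OF g] ip_sym[OF g f] by (simp add: algebra_simps power2_eq_square)
  finally have "0 \<le> ip f f * ip g g - (ip f g)\<^sup>2"
    using ip_nonneg[OF h] pos by (simp add: zero_le_mult_iff)
  then have "sqrt ((ip f g)\<^sup>2) \<le> sqrt (ip f f * ip g g)"
    by (intro real_sqrt_le_mono) simp
  then show ?thesis
    by (simp add: real_sqrt_mult)
qed

definition section_comb :: "'a^'j::finite \<Rightarrow> real^'j \<Rightarrow> 'a \<Rightarrow> real" where
  "section_comb Zs a = (\<lambda>w\<in>Z. \<Sum>j\<in>UNIV. a $ j * c w (Zs $ j))"

lemma section_comb_mem_and_ip:
  fixes Zs :: "'a^'j::finite"
  assumes Zs: "\<And>j. Zs $ j \<in> Z"
  shows "section_comb Zs a \<in> H"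
    and "f \<in> H \<Longrightarrow> ip (section_comb Zs a) f = a \<bullet> (\<chi> j. f (Zs $ j))"
proof -
  have partial: "(\<lambda>w\<in>Z. \<Sum>j\<in>A. a $ j * c w (Zs $ j)) \<in> H \<and>
      (\<forall>f\<in>H. ip (\<lambda>w\<in>Z. \<Sum>j\<in>A. a $ j * c w (Zs $ j)) f = (\<Sum>j\<in>A. a $ j * f (Zs $ j)))"
    if "finite A" for A
    using that
  proof induction
    case empty
    then show ?case
      unfolding sum.empty using zero_mem ip_zero_right ip_sym[OF zero_mem] by metis
  next
    case (insert k A)
    let ?k = "\<lambda>w\<in>Z. c w (Zs $ k)" and ?s = "\<lambda>w\<in>Z. \<Sum>j\<in>A. a $ j * c w (Zs $ j)"
    have k: "?k \<in> H"
      using Zs by (rule section_mem)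
    have s: "?s \<in> H" and ip_s: "\<forall>f\<in>H. ip ?s f = (\<Sum>j\<in>A. a $ j * f (Zs $ j))"
      using insert.IH by (rule conjunct1, rule conjunct2)
    have eq: "(\<lambda>w\<in>Z. \<Sum>j\<in>insert k A. a $ j * c w (Zs $ j)) = (\<lambda>w\<in>Z. a $ k * ?k w + 1 * ?s w)"
      using insert.hyps by (auto simp: restrict_def)
    have "ip (\<lambda>w\<in>Z. a $ k * ?k w + 1 * ?s w) f = (\<Sum>j\<in>insert k A. a $ j * f (Zs $ j))"
      if f: "f \<in> H" for f
    proof -
      have "ip ?k f = f (Zs $ k)"
        using reproducing[OF Zs f] ip_sym[OF k f] by (rule trans[rotated])
      then show ?thesis
        using insert.hyps ip_s[THEN bspec, OF f] by (simp only: ip_lincomb[OF k s f] sum.insert) simp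
    qed
    then show ?case
      unfolding eq using lincomb_mem[OF k s, of "a $ k" 1] by blast
  qed
  show "section_comb Zs a \<in> H" "f \<in> H \<Longrightarrow> ip (section_comb Zs a) f = a \<bullet> (\<chi> j. f (Zs $ j))"
    using partial[of UNIV] by (auto simp: section_comb_def inner_vec_def)
qed

lemma section_comb_at_site:
  fixes Zs :: "'a^'j::finite"
  assumes "\<And>j. Zs $ j \<in> Z"
  shows "section_comb Zs a (Zs $ k) = (gram c Zs *v a) $ k"
  using assms by (simp add: section_comb_def gram_def matrix_vector_mult_def mult.commute)

lemma section_comb_at:
  fixes Zs :: "'a^'j::finite"
  assumes "\<And>j. Zs $ j \<in> Z" "z \<in> Z"
  shows "section_comb Zs a z = a \<bullet> cross c Zs z"
  using assms kernel_sym[OF assms(2)] by (simp add: section_comb_def cross_def inner_vec_def)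

text \<open>The residual \<open>g\<close> of the section at \<open>z\<close> and the residual \<open>e\<close> of \<open>f\<close>, each after interpolation at
  the sites, satisfy \<open>\<langle>e, g\<rangle> = \<langle>f, g\<rangle>\<close> because \<open>g\<close> is orthogonal to interpolants.  The two factors of the bound
  are their norms, computed by the same orthogonality.  That the power function is such a norm also
  gives its nonnegativity, which is not automatic since the real square root is odd.\<close>

lemma
  fixes Zs :: "'a^'j::finite" and f :: "'a \<Rightarrow> real"
  assumes Zs: "\<And>j. Zs $ j \<in> Z" and z: "z \<in> Z" and f: "f \<in> H"
    and C: "invertible (gram c Zs)"
  defines "fZ \<equiv> \<chi> j. f (Zs $ j)"
  shows power_function_nonneg: "0 \<le> power_function c Zs z"
    and interpolation_error: "\<bar>f z - fZ \<bullet> (matrix_inv (gram c Zs) *v cross c Zs z)\<bar>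
      \<le> power_function c Zs z * sqrt (ip f f - fZ \<bullet> (matrix_inv (gram c Zs) *v fZ))"
proof -
  define a where "a = matrix_inv (gram c Zs) *v cross c Zs z"
  define p where "p = matrix_inv (gram c Zs) *v fZ"
  define t where "t = section_comb Zs a"
  define s where "s = section_comb Zs p"
  define k where "k = (\<lambda>w\<in>Z. c w z)"
  define g where "g = (\<lambda>w\<in>Z. k w - t w)"
  define e where "e = (\<lambda>w\<in>Z. f w - s w)"
  have Ca: "gram c Zs *v a = cross c Zs z" and Cp: "gram c Zs *v p = fZ"
    unfolding a_def p_def by (rule matrix_inv_mult_vector(1)[OF C])+
  have mem: "k \<in> H" "t \<in> H" "s \<in> H"
    unfolding k_def t_def s_def using section_mem[OF z] section_comb_mem_and_ip(1)[OF Zs] by auto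
  then have mem': "g \<in> H" "e \<in> H"
    unfolding g_def e_def using f by (auto intro: diff_mem)
  have g_site: "g (Zs $ j) = 0" and e_site: "e (Zs $ j) = 0" for j
    using Zs[of j] section_comb_at_site[OF Zs]
    by (simp_all add: g_def e_def k_def t_def s_def Ca Cp cross_def fZ_def)
  have orth: "ip (section_comb Zs q) g = 0" "ip (section_comb Zs q) e = 0" for q
    by (simp_all add: section_comb_mem_and_ip(2)[OF Zs] mem' g_site e_site inner_vec_def)
  have "ip e g = ip f g"
    using orth(1)[of p] ip_diff_left[OF f mem(3) mem'(1)] by (simp add: e_def s_def)
  also have "\<dots> = f z - fZ \<bullet> a"
    using ip_diff_right[OF mem(1,2) f] reproducing[OF z f] section_comb_mem_and_ip(2)[OF Zs f, of a]
      ip_sym[OF f mem(2)]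
    by (simp add: g_def k_def t_def fZ_def inner_commute)
  finally have eg: "ip e g = f z - fZ \<bullet> a" .
  have "ip g g = ip k g"
    using orth(1)[of a] ip_diff_left[OF mem(1,2) mem'(1)] by (simp add: g_def t_def)
  also have "\<dots> = g z"
    using reproducing[OF z mem'(1)] ip_sym[OF mem(1) mem'(1)] by (simp add: k_def)
  also have "\<dots> = c z z - cross c Zs z \<bullet> a"
    using z section_comb_at[OF Zs z, of a] by (simp add: g_def k_def t_def inner_commute)
  finally have gg: "ip g g = c z z - cross c Zs z \<bullet> a" .
  have "ip e e = ip f e"
    using orth(2)[of p] ip_diff_left[OF f mem(3) mem'(2)] by (simp add: e_def s_def)
  also have "\<dots> = ip f f - fZ \<bullet> p"
    using ip_diff_right[OF f mem(3) f] section_comb_mem_and_ip(2)[OF Zs f, of p] ip_sym[OF f mem(3)]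
    by (simp add: e_def s_def fZ_def inner_commute)
  finally have ee: "ip e e = ip f f - fZ \<bullet> p" .
  show "0 \<le> power_function c Zs z"
    using ip_nonneg[OF mem'(1)] by (simp add: gg power_function_def a_def)
  show "\<bar>f z - fZ \<bullet> (matrix_inv (gram c Zs) *v cross c Zs z)\<bar>
      \<le> power_function c Zs z * sqrt (ip f f - fZ \<bullet> (matrix_inv (gram c Zs) *v fZ))"
    using Cauchy_Schwarz[OF mem'(2,1)]
    by (simp add: eg gg ee power_function_def a_def p_def mult.commute)
qed

end

section \<open>The error bound for the regularized predictor\<close>

lemma inner_le_inner_abs_vec:
  assumes "\<And>j. \<bar>r $ j\<bar> \<le> rbar $ j"
  shows "\<bar>r \<bullet> a\<bar> \<le> rbar \<bullet> abs_vec a"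
proof -
  have "\<bar>r \<bullet> a\<bar> \<le> (\<Sum>j\<in>UNIV. \<bar>r $ j * a $ j\<bar>)"
    by (simp add: inner_vec_def sum_abs)
  also have "\<dots> \<le> (\<Sum>j\<in>UNIV. rbar $ j * \<bar>a $ j\<bar>)"
    using assms by (intro sum_mono) (simp add: abs_mult mult_right_mono)
  finally show ?thesis
    by (simp add: inner_vec_def abs_vec_def)
qed

lemma le_discrepancy_max:
  assumes "\<And>j. \<bar>q $ j\<bar> \<le> rbar $ j"
  shows "- (q \<bullet> (matrix_inv (gram c Zs) *v q)) + 2 * (yc \<bullet> (matrix_inv (gram c Zs) *v q))
    \<le> discrepancy_max c Zs yc rbar"
proof -
  have "0 \<le> rbar $ j" for j
    using assms[of j] by linarith
  from discrepancy_max_attained[OF this] show ?thesis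
    using assms by metis
qed

text \<open>The perturbation \<open>r = yc - fZ\<close> of the data enters twice: inside the square root, where it is an
  admissible \<open>q\<close> of the discrepancy maximum, and linearly against \<open>a = C\<inverse> b\<close>.  The scaling
  \<open>d / real CARD('j)\<close> of the regularization turns the factor \<open>(J \<gamma>)\<inverse>\<close> in \<open>Q_matrix\<close> into \<open>d\<inverse>\<close>, as
  the resolvent identity requires.\<close>

lemma (in rkhs) ridge_regression_error:
  fixes Zs :: "'a^'j::finite" and f :: "'a \<Rightarrow> real"
  assumes c: "positive_definite_kernel_on Z c"
    and Zs: "\<And>j. Zs $ j \<in> Z" "inj (($) Zs)" and z: "z \<in> Z"
    and f: "f \<in> H" "sqrt (ip f f) \<le> \<Gamma>"
    and yc: "\<And>j. \<bar>yc $ j - f (Zs $ j)\<bar> \<le> rbar $ j"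
    and d: "0 < d"
  shows "\<bar>yc \<bullet> (matrix_inv (gram c Zs + d *\<^sub>R mat 1) *v cross c Zs z) - f z\<bar>
    \<le> krr_bound c Zs yc rbar \<Gamma> (d / real CARD('j)) z"
proof -
  define Ci where "Ci = matrix_inv (gram c Zs)"
  define fZ where "fZ = (\<chi> j. f (Zs $ j))"
  define r where "r = yc - fZ"
  define a where "a = Ci *v cross c Zs z"
  define rv where "rv = matrix_inv (gram c Zs + d *\<^sub>R mat 1) *v cross c Zs z"
  define qv where "qv = matrix_inv (Q_matrix c Zs (d / real CARD('j))) *v cross c Zs z"
  have r: "\<bar>r $ j\<bar> \<le> rbar $ j" for j
    using yc[of j] by (simp add: r_def fZ_def)
  have C: "invertible (gram c Zs)" and Cd: "invertible (gram c Zs + d *\<^sub>R mat 1)"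
    using invertible_gram_plus_ridge[OF c Zs, of 0] invertible_gram_plus_ridge[OF c Zs, of d] d
    by auto
  have sym: "gram c Zs $ j $ k = gram c Zs $ k $ j" for j k
    using kernel_sym Zs(1) by (simp add: gram_def)
  \<comment> \<open>Passing from the unobserved \<open>fZ\<close> to the data \<open>yc\<close> costs exactly the objective at \<open>q = r\<close>.\<close>
  have "ip f f - fZ \<bullet> (Ci *v fZ) \<le> \<Gamma>\<^sup>2 + discrepancy_max c Zs yc rbar - yc \<bullet> (Ci *v yc)"
  proof -
    have fZ: "fZ = yc - r"
      by (simp add: r_def)
    have "fZ \<bullet> (Ci *v fZ) = yc \<bullet> (Ci *v yc) - 2 * (yc \<bullet> (Ci *v r)) + r \<bullet> (Ci *v r)"
      unfolding fZ Ci_def using inner_symmetric_matrix_inv[OF sym C, of yc r]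
      by (simp add: matrix_vector_mult_diff_distrib inner_diff_left inner_diff_right)
    moreover have "ip f f \<le> \<Gamma>\<^sup>2"
      using f(2) by (metis sqrt_le_D)
    ultimately show ?thesis
      using le_discrepancy_max[of r rbar c Zs yc, OF r] by (simp add: Ci_def)
  qed
  moreover have "0 \<le> power_function c Zs z"
    using power_function_nonneg[OF Zs(1) z f(1) C] .
  ultimately have "power_function c Zs z * sqrt (ip f f - fZ \<bullet> (Ci *v fZ))
      \<le> power_function c Zs z
        * sqrt (\<Gamma>\<^sup>2 + discrepancy_max c Zs yc rbar - yc \<bullet> (Ci *v yc))"
    by (intro mult_left_mono real_sqrt_le_mono)
  then have interp: "\<bar>f z - fZ \<bullet> a\<bar> \<le> power_function c Zs z
        * sqrt (\<Gamma>\<^sup>2 + discrepancy_max c Zs yc rbar - yc \<bullet> (Ci *v yc))"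
    using interpolation_error[OF Zs(1) z f(1) C] by (simp add: Ci_def a_def fZ_def)
  have "a - rv = qv"
    using ridge_resolvent_difference[OF C Cd, of "cross c Zs z"] d
    by (simp add: a_def rv_def qv_def Ci_def Q_matrix_def)
  then have "yc \<bullet> rv - f z = - (f z - fZ \<bullet> a) + r \<bullet> a - yc \<bullet> qv"
    by (auto simp: r_def inner_diff_left inner_diff_right)
  then have "\<bar>yc \<bullet> rv - f z\<bar> \<le> \<bar>f z - fZ \<bullet> a\<bar> + \<bar>r \<bullet> a\<bar> + \<bar>yc \<bullet> qv\<bar>"
    by linarith
  also have "\<dots> \<le> krr_bound c Zs yc rbar \<Gamma> (d / real CARD('j)) z"
    using interp inner_le_inner_abs_vec[OF r, of a]
    by (simp add: krr_bound_def a_def qv_def Ci_def)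
  finally show ?thesis
    by (simp add: rv_def)
qed

theorem proposition3:
  fixes M :: "'d::finite mesh" and f u0 :: "real^'d \<Rightarrow> real"
    and P :: "'w measure" and run :: "'w \<Rightarrow> 'd ms_run" and lev nb :: "'w \<Rightarrow> nat"
    and Z :: "'w \<Rightarrow> real^(4 + 'd)" and Y :: "'w \<Rightarrow> real"
    and ZZ :: "(real^(4 + 'd)) set" and m_star :: "real^(4 + 'd) \<Rightarrow> real"
    and w :: "'j::finite \<Rightarrow> 'w" and Zs :: "(real^(4 + 'd))^'j" and y :: "real^'j"
    and fam :: "real \<Rightarrow> real^(4 + 'd) \<Rightarrow> real^(4 + 'd) \<Rightarrow> real^(4 + 'd) \<Rightarrow> real"
    and c :: "real^(4 + 'd) \<Rightarrow> real^(4 + 'd) \<Rightarrow> real"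
    and \<sigma>2 \<zeta> \<delta>2 \<gamma> \<Gamma> :: real and \<beta> :: "real^(4 + 'd)"
    and H :: "(real^(4 + 'd) \<Rightarrow> real) set"
    and ip :: "(real^(4 + 'd) \<Rightarrow> real) \<Rightarrow> (real^(4 + 'd) \<Rightarrow> real) \<Rightarrow> real"
    and rbar :: "real^'j"
    and R :: "'d ms_run" and S :: "(nat \<times> nat) set" and rbar_on :: "nat \<Rightarrow> nat \<Rightarrow> real"
  assumes mesh: "wf_mesh M" and source: "square_integrable_on f (region M)"
    and prob: "prob_space P"
    and offline: "\<And>\<omega>. \<omega> \<in> space P \<Longrightarrow>
          is_ms_run M f u0 (run \<omega>) \<and> online_state M (run \<omega>) (lev \<omega>) (nb \<omega>)"
    and Z_def: "\<And>\<omega>. \<omega> \<in> space P \<Longrightarrow> Z \<omega> = feature M (run \<omega>) (lev \<omega>) (nb \<omega>)"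
    and Y_def: "\<And>\<omega>. \<omega> \<in> space P \<Longrightarrow> Y \<omega> = indicator_sq M f (run \<omega>) (lev \<omega>) (nb \<omega>)"
    and Z_meas: "Z \<in> borel_measurable P" and Y_int: "integrable P Y"
    and m_star_meas: "set_borel_measurable borel ZZ m_star"
    and m_star: "AE \<omega> in P. Z \<omega> \<in> ZZ \<longrightarrow>
          m_star (Z \<omega>) = real_cond_exp P (vimage_algebra (space P) Z borel) Y \<omega>"
    and training: "\<And>j. w j \<in> space P \<and> Zs $ j = Z (w j) \<and> y $ j = Y (w j) \<and> Zs $ j \<in> ZZ"
    and family: "fam = matern32 \<or> fam = matern52" and c_def: "c = fam \<sigma>2 \<beta>"
    and fitted: "fitted_parameters fam Zs y \<sigma>2 \<beta> \<zeta> \<delta>2"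
    and online: "is_ms_run M f u0 R"
          "\<And>m i. (m, i) \<in> S \<Longrightarrow> online_state M R m i \<and> feature M R m i \<in> ZZ"
    and cond1: "compact ZZ" "continuous_on (ZZ \<times> ZZ) (\<lambda>(z, z'). c z z')"
          "positive_definite_kernel_on ZZ c"
    and cond2: "inj (($) Zs)"
    and cond3: "0 < \<delta>2" "\<gamma> = \<delta>2 / real CARD('j)"
    and cond4: "rkhs ZZ c H ip" "(\<lambda>z\<in>ZZ. m_star z - \<zeta>) \<in> H"
          "sqrt (ip (\<lambda>z\<in>ZZ. m_star z - \<zeta>) (\<lambda>z\<in>ZZ. m_star z - \<zeta>)) \<le> \<Gamma>"
    and cond5: "\<And>j. 0 < rbar $ j" "\<And>j. \<bar>y $ j - m_star (Zs $ j)\<bar> \<le> rbar $ j"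
    and cond6: "\<And>m i. (m, i) \<in> S \<Longrightarrow> 0 \<le> rbar_on m i \<and>
          \<bar>indicator_sq M f R m i - m_star (feature M R m i)\<bar> \<le> rbar_on m i"
  shows "\<forall>(m, i)\<in>S.
     \<bar>posterior_mean c Zs y \<zeta> \<delta>2 (feature M R m i) - indicator_sq M f R m i\<bar>
       \<le> krr_bound c Zs (y - vec \<zeta>) rbar \<Gamma> \<gamma> (feature M R m i) + rbar_on m i"
proof (intro ballI, clarify)
  fix m i assume mi: "(m, i) \<in> S"
  let ?z = "feature M R m i" and ?f = "\<lambda>z\<in>ZZ. m_star z - \<zeta>"
  interpret rkhs ZZ c H ip
    by (rule cond4(1))
  have z: "?z \<in> ZZ" and Zs: "\<And>j. Zs $ j \<in> ZZ"
    using online(2)[OF mi] training by blast+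
  have "\<bar>(y - vec \<zeta>) $ j - ?f (Zs $ j)\<bar> \<le> rbar $ j" for j
    using cond5(2)[of j] Zs by simp
  from ridge_regression_error[OF cond1(3) Zs cond2 z cond4(2,3) this cond3(1)]
  have "\<bar>posterior_mean c Zs y \<zeta> \<delta>2 ?z - m_star ?z\<bar> \<le> krr_bound c Zs (y - vec \<zeta>) rbar \<Gamma> \<gamma> ?z"
    using z by (simp add: posterior_mean_def cond3(2) algebra_simps)
  then show "\<bar>posterior_mean c Zs y \<zeta> \<delta>2 ?z - indicator_sq M f R m i\<bar>
      \<le> krr_bound c Zs (y - vec \<zeta>) rbar \<Gamma> \<gamma> ?z + rbar_on m i"
    using cond6[OF mi] by linarith
qed

end
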